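(* Let $w$ be an infinite word over a finite alphabet $A$ and let $B \subseteq A$ contain at least two different letters. The following assertions are equivalent: (1) $w$ is ultimately $B$-strict epistandard, i.e. $w$ is epistandard and $Ult(\Delta(w)) = B$; (2) for each letter $a \in A$, the word $aw$ is episturmian if and only if $a \in B$.
   Context: $Fact(w)$ is the set of factors of $w$. A factor $u$ of $w$ is left special if there are two different letters $a,b$ with $au, bu$ factors of $w$. An infinite word $w$ is episturmian if $Fact(w)$ is closed under mirror image (reversal) and $w$ has at most one left special factor of each length; it is epistandard if it is episturmian and all its left special factors are prefixes of $w$. For a letter $a$, $L_a$ is the morphism with $L_a(a)=a$ and $L_a(b)=ab$ for $b\ne a$. An infinite word $s$ is epistandard if and only if there are a sequence of letters $(x_n)_{n\ge1}$ and infinite words $s^{(n)}$ with $s^{(0)}=s$ and $s^{(n-1)}=L_{x_n}(s^{(n)})$ for all $n\geq 1$; the directive word $\Delta(s)=(x_n)_{n\ge1}$ is this sequence (unique for each epistandard word). $Ult(\Delta(w))$ is the set of letters occurring infinitely often in $\Delta(w)$. *)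

theory Defs
  imports "HOL-Library.Stream"
begin

definition factors :: "'a stream \<Rightarrow> 'a list set" where
  "factors w = {u. \<exists>p s. w = p @- u @- s}"

definition is_prefix :: "'a list \<Rightarrow> 'a stream \<Rightarrow> bool" where
  "is_prefix u w \<longleftrightarrow> (\<exists>s. w = u @- s)"

definition left_special :: "'a stream \<Rightarrow> 'a list \<Rightarrow> bool" where
  "left_special w u \<longleftrightarrow>
     u \<in> factors w \<and> (\<exists>a b. a \<noteq> b \<and> a # u \<in> factors w \<and> b # u \<in> factors w)"

definition episturmian :: "'a stream \<Rightarrow> bool" where
  "episturmian w \<longleftrightarrow>
     (\<forall>u \<in> factors w. rev u \<in> factors w) \<and>
     (\<forall>u v. left_special w u \<and> left_special w v \<and> length u = length v \<longrightarrow> u = v)"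

definition epistandard :: "'a stream \<Rightarrow> bool" where
  "epistandard w \<longleftrightarrow> episturmian w \<and> (\<forall>u. left_special w u \<longrightarrow> is_prefix u w)"

definition L_letter :: "'a \<Rightarrow> 'a \<Rightarrow> 'a list" where
  "L_letter a b = (if b = a then [a] else [a, b])"

definition L :: "'a \<Rightarrow> 'a stream \<Rightarrow> 'a stream" where
  "L a t = flat (smap (L_letter a) t)"

text \<open>Streams are indexed from 0, so \<open>x !! n\<close> is the letter usually written $x_{n+1}$.\<close>

definition directs :: "'a stream \<Rightarrow> 'a stream \<Rightarrow> bool" where
  "directs x s \<longleftrightarrow>
     (\<exists>S :: nat \<Rightarrow> 'a stream. S 0 = s \<and> (\<forall>n. S n = L (x !! n) (S (Suc n))))"

text \<open>Only meaningful if some directive sequence exists, as is the case for epistandard words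
  over a finite alphabet. Uniqueness is the lemma \<open>directs_unique\<close> below.\<close>

definition directive_word :: "'a stream \<Rightarrow> 'a stream" where
  "directive_word s = (THE x. directs x s)"

definition Ult :: "'a stream \<Rightarrow> 'a set" where
  "Ult x = {a. infinite {n. x !! n = a}}"

definition ultimately_strict_epistandard :: "'a set \<Rightarrow> 'a stream \<Rightarrow> bool" where
  "ultimately_strict_epistandard B w \<longleftrightarrow> epistandard w \<and> Ult (directive_word w) = B"

lemma L_unfold: "L a t = L_letter a (shd t) @- L a (stl t)"
  unfolding L_def
  by (cases t) (simp add: L_letter_def)

lemma shd_L: "shd (L a t) = a"
  using L_unfold[of a t] by (simp add: L_letter_def)

lemma L_inj_step:
  assumes "L a t = L a t'"
  shows "shd t = shd t' \<and> L a (stl t) = L a (stl t')"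
proof -
  have eq: "L_letter a (shd t) @- L a (stl t) = L_letter a (shd t') @- L a (stl t')"
    using assms L_unfold[of a t] L_unfold[of a t'] by argo
  show ?thesis
  proof (cases "shd t = shd t'")
    case True
    with eq show ?thesis by (auto simp: L_letter_def split: if_splits)
  next
    case False
    have "shd (stl (L_letter a (shd t) @- L a (stl t))) = shd (stl (L_letter a (shd t') @- L a (stl t')))"
      by (simp only: eq)
    with False show ?thesis using arg_cong[OF eq, of shd]
      by (auto simp: L_letter_def shd_L split: if_splits)
  qed
qed

lemma L_inj:
  assumes "L a t = L b t'"
  shows "a = b \<and> t = t'"
proof -
  have ab: "a = b" using arg_cong[OF assms, of shd] by (simp add: shd_L)
  have "L a t = L a t' \<Longrightarrow> t = t'"
  proof (coinduction arbitrary: t t' rule: stream.coinduct_strong)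
    case Eq_stream
    then show ?case using L_inj_step[of a t t'] by auto
  qed
  with assms ab show ?thesis by simp
qed

lemma directs_unique:
  assumes "directs x s" "directs y s"
  shows "x = y"
proof -
  obtain S where S: "S 0 = s" "\<And>n. S n = L (x !! n) (S (Suc n))"
    using assms(1) unfolding directs_def by (elim exE conjE) (rule that, assumption, erule spec)
  obtain T where T: "T 0 = s" "\<And>n. T n = L (y !! n) (T (Suc n))"
    using assms(2) unfolding directs_def by (elim exE conjE) (rule that, assumption, erule spec)
  have eq: "S n = T n" for n
  proof (induction n)
    case 0
    then show ?case using S(1) T(1) by simp
  next
    case (Suc n)
    have "L (x !! n) (S (Suc n)) = L (y !! n) (T (Suc n))"
      by (rule box_equals[OF Suc.IH S(2) T(2)])
    then show ?case by (rule L_inj[THEN conjunct2])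
  qed
  have nth: "x !! n = y !! n" for n
  proof -
    have "L (x !! n) (S (Suc n)) = L (y !! n) (T (Suc n))"
      by (rule box_equals[OF eq S(2) T(2)])
    then show ?thesis by (rule L_inj[THEN conjunct1])
  qed
  have "smap ((!!) x) nats = smap ((!!) y) nats"
    by (rule stream.map_cong0) (rule nth)
  then show ?thesis
    by (rule box_equals[OF _ stream_smap_nats[symmetric] stream_smap_nats[symmetric]])
qed

lemma directive_word_eq: "directs x s \<Longrightarrow> directive_word s = x"
  unfolding directive_word_def by (rule the_equality) (auto intro: directs_unique)

end

theory Submission
  imports Defs "HOL-Library.Infinite_Set"
begin

text \<open>
  Let $E(w)$ be the set of letters $a$ such that $au$ is a factor of $w$ for every prefix $u$
  of $w$. Closure under reversal forces every factor of $aw$ to be a factor of $w$, so for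
  episturmian $w$ the word $aw$ is episturmian iff $a \in E(w)$. If $w$ is directed by
  $(x_n)$ through $(s^{(n)})$, then $E(w) = Ult((x_n))$: decoding gives
  $E(L_x(t)) \subseteq E(t)$, so a letter of $E(w)$ occurs in every $s^{(n)}$ and hence in
  every tail of $(x_n)$; conversely each application of $L_x$ lengthens by one the prefixes
  of $t$ which extend to the left by $a$, so a letter occurring in infinitely many
  $s^{(n)}$ lies in $E(w)$.
\<close>

section \<open>Factors and prefixes\<close>

lemma is_prefix_iff_stake: "is_prefix u w \<longleftrightarrow> u = stake (length u) w"
proof
  assume "is_prefix u w"
  then show "u = stake (length u) w"
    unfolding is_prefix_def by (auto simp: stake_shift)
next
  assume "u = stake (length u) w"
  then have "w = u @- sdrop (length u) w"
    by (metis stake_sdrop)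
  then show "is_prefix u w"
    unfolding is_prefix_def by blast
qed

lemma is_prefix_stake: "is_prefix (stake k w) w"
  unfolding is_prefix_def by (metis stake_sdrop)

lemma factorsI: "w = p @- u @- s \<Longrightarrow> u \<in> factors w"
  unfolding factors_def by blast

lemma factorsE:
  assumes "u \<in> factors w"
  obtains p s where "w = p @- u @- s"
  using assms unfolding factors_def by blast

lemma factors_infix:
  assumes "p @ u @ s \<in> factors w"
  shows "u \<in> factors w"
proof -
  obtain p' s' where "w = p' @- (p @ u @ s) @- s'"
    using assms by (rule factorsE)
  then have "w = (p' @ p) @- u @- (s @- s')"
    by simp
  then show ?thesis
    by (rule factorsI)
qed

lemma factors_pair: "[w !! i, w !! Suc i] \<in> factors w"
proof (rule factorsI)
  show "w = stake i w @- [w !! i, w !! Suc i] @- sdrop (Suc (Suc i)) w"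
    by (metis id_stake_snth_sdrop stake_sdrop sdrop_simps shift.simps stream.collapse)
qed

lemma factors_Stream: "factors w \<subseteq> factors (a ## w)"
proof
  fix u assume "u \<in> factors w"
  then obtain p s where "w = p @- u @- s" by (rule factorsE)
  then have "a ## w = (a # p) @- u @- s" by simp
  then show "u \<in> factors (a ## w)" by (rule factorsI)
qed

section \<open>Left extensions of prefixes\<close>

text \<open>This is the set $E(w)$ of the opening comment.\<close>

definition prefix_extensions :: "'a stream \<Rightarrow> 'a set" where
  "prefix_extensions w = {a. \<forall>k. a # stake k w \<in> factors w}"

lemma prefix_extensionsD:
  assumes "a \<in> prefix_extensions w" and "is_prefix u w"
  shows "a # u \<in> factors w"
  using assms unfolding prefix_extensions_def is_prefix_iff_stake
  by (metis (mono_tags) mem_Collect_eq)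

lemma stake_factor_le:
  assumes "is_prefix u w" and "a # u \<in> factors w" and "k \<le> length u"
  shows "a # stake k w \<in> factors w"
proof -
  have "stake k w = take k u"
    using assms(1,3) unfolding is_prefix_def by (auto simp: stake_shift)
  then have "a # u = [] @ (a # stake k w) @ drop k u"
    by simp
  with assms(2) show ?thesis
    by (metis factors_infix)
qed

lemma factors_Stream_eq:
  assumes "a \<in> prefix_extensions w"
  shows "factors (a ## w) = factors w"
proof
  show "factors w \<subseteq> factors (a ## w)" by (rule factors_Stream)
  show "factors (a ## w) \<subseteq> factors w"
  proof
    fix u assume "u \<in> factors (a ## w)"
    then obtain p s where eq: "a ## w = p @- u @- s" by (rule factorsE)
    show "u \<in> factors w"
    proof (cases p)
      case (Cons c p')
      with eq show ?thesis by (auto intro: factorsI)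
    next
      case p: Nil
      show ?thesis
      proof (cases u)
        case Nil
        then show ?thesis by (auto intro: factorsI[of _ "[]"])
      next
        case (Cons c u')
        with eq p have "c = a" "is_prefix u' w"
          by (auto simp: is_prefix_def)
        with assms Cons show ?thesis
          by (auto intro: prefix_extensionsD)
      qed
    qed
  qed
qed

text \<open>Take an occurrence of \<open>rev u\<close> together with the letter after it. In the
  reversed factor that letter stands before \<open>u\<close>, so \<open>u\<close> also occurs at a
  positive position.\<close>

lemma factors_stl_if_rev_closed:
  assumes "\<forall>u \<in> factors w. rev u \<in> factors w" and "u \<in> factors w"
  shows "u \<in> factors (stl w)"
proof -
  obtain p s where "w = p @- rev u @- s"
    using assms by (metis factorsE)
  then have "w = [] @- (p @ rev u @ [shd s]) @- stl s"
    by simp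
  then have "p @ rev u @ [shd s] \<in> factors w"
    by (rule factorsI)
  then have "rev (p @ rev u @ [shd s]) \<in> factors w"
    using assms(1) by blast
  then obtain p' s' where eq: "w = p' @- rev (p @ rev u @ [shd s]) @- s'"
    by (rule factorsE)
  \<comment> \<open>Writing the removed letter inside \<open>tl\<close> treats both cases at once:
    it is the first letter of \<open>p'\<close>, or \<open>shd s\<close> itself if \<open>p'\<close>
    is empty.\<close>
  have "stl w = tl (p' @ [shd s]) @- u @- rev p @- s'"
    by (subst eq) (cases p'; simp)
  then show ?thesis
    by (rule factorsI)
qed

lemma episturmian_cong: "factors v = factors w \<Longrightarrow> episturmian v \<longleftrightarrow> episturmian w"
  unfolding episturmian_def left_special_def by simp

text \<open>Each \<open>a # stake k w\<close> is a prefix of \<open>a ## w\<close>. By closure under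
  reversal it occurs there again away from the start, hence in \<open>w\<close>.\<close>

lemma prefix_extensions_if_episturmian_Stream:
  assumes "episturmian (a ## w)"
  shows "a \<in> prefix_extensions w"
proof -
  have "a # stake k w \<in> factors (a ## w)" for k
    by (rule factorsI[of _ "[]" _ "sdrop k w"]) (simp add: stake_sdrop)
  then show ?thesis
    using factors_stl_if_rev_closed[of "a ## w"] assms
    unfolding episturmian_def prefix_extensions_def by simp
qed

lemma episturmian_Stream_iff:
  assumes "episturmian w"
  shows "episturmian (a ## w) \<longleftrightarrow> a \<in> prefix_extensions w"
  using assms prefix_extensions_if_episturmian_Stream factors_Stream_eq episturmian_cong
  by metis

section \<open>Coding and decoding with \<open>L\<close>\<close>

definition L_list :: "'a \<Rightarrow> 'a list \<Rightarrow> 'a list" where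
  "L_list x v = concat (map (L_letter x) v)"

lemma L_list_simps [simp]:
  "L_list x [] = []"
  "L_list x (b # v) = L_letter x b @ L_list x v"
  "L_list x (u @ v) = L_list x u @ L_list x v"
  by (simp_all add: L_list_def)

lemma L_shift: "L x (v @- t) = L_list x v @- L x t"
proof (induction v)
  case (Cons b v)
  then show ?case using L_unfold[of x "b ## v @- t"] by simp
qed simp

lemma L_same: "shd t = x \<Longrightarrow> L x t = x ## L x (stl t)"
  by (subst L_unfold) (simp add: L_letter_def)

lemma L_other: "shd t \<noteq> x \<Longrightarrow> L x t = x ## shd t ## L x (stl t)"
  by (subst L_unfold) (simp add: L_letter_def)

lemma length_L_list: "length v \<le> length (L_list x v)"
  by (induction v) (auto simp: L_letter_def)

lemma L_list_eq_Nil: "L_list x v = [] \<longleftrightarrow> v = []"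
  by (cases v) (auto simp: L_letter_def)

lemma last_L_list: "v \<noteq> [] \<Longrightarrow> last (L_list x v) = last v"
  by (induction v) (auto simp: L_letter_def L_list_eq_Nil)

text \<open>Reversal turns a block \<open>[x, b]\<close> into \<open>[b, x]\<close>; the extra
  \<open>x\<close> at the end moves every block boundary by one letter and restores the form
  \<open>[x, b]\<close>.\<close>

lemma rev_L_list: "rev (L_list x v @ [x]) = L_list x (rev v) @ [x]"
  by (induction v) (auto simp: L_letter_def)

text \<open>The blocks of \<open>L x t\<close> start exactly at the occurrences of \<open>x\<close>.\<close>

lemma L_split:
  assumes "L x t = p @- s" and "shd s = x"
  shows "\<exists>q t'. t = q @- t' \<and> p = L_list x q \<and> s = L x t'"
  using assms
proof (induction p arbitrary: t rule: length_induct)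
  case (1 p)
  show ?case
  proof (cases p)
    case Nil
    with 1 show ?thesis by (intro exI[of _ "[]"] exI[of _ t]) simp
  next
    case (Cons c p')
    show ?thesis
    proof (cases "shd t = x")
      case True
      with 1(2) Cons have c: "c = x" and "L x (stl t) = p' @- s"
        by (auto simp: L_same)
      then obtain q t' where "stl t = q @- t'" "p' = L_list x q" "s = L x t'"
        using 1(1)[rule_format, of p' "stl t"] 1(3) Cons by auto
      then show ?thesis
        using True Cons c stream.collapse[of t]
        by (intro exI[of _ "x # q"] exI[of _ t']) (simp add: L_letter_def)
    next
      case False
      with 1(2) Cons have c: "c = x" and eq: "shd t ## L x (stl t) = p' @- s"
        by (auto simp: L_other)
      \<comment> \<open>The cut cannot fall inside a two-letter block, since \<open>s\<close> would
        then start with \<open>shd t\<close>, which differs from \<open>x\<close>.\<close>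
      from eq False 1(3) obtain p'' where p': "p' = shd t # p''"
        by (cases p') auto
      with eq have "L x (stl t) = p'' @- s" by simp
      then obtain q t' where "stl t = q @- t'" "p'' = L_list x q" "s = L x t'"
        using 1(1)[rule_format, of p'' "stl t"] 1(3) Cons p' by auto
      then show ?thesis
        using False Cons c p' stream.collapse[of t]
        by (intro exI[of _ "shd t # q"] exI[of _ t']) (simp add: L_letter_def)
    qed
  qed
qed

lemma shd_L_list_shift: "shd s = x \<Longrightarrow> shd (L_list x v @- s) = x"
  by (cases v) (auto simp: L_letter_def)

text \<open>The word is cut twice at an \<open>x\<close>, before and after the coded
  \<open>v\<close>; injectivity of \<open>L\<close> then identifies what was coded from the first
  cut on.\<close>

lemma L_decode:
  assumes "L x t = p @- L_list x v @- s" and "shd s = x"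
  shows "\<exists>q t'. t = q @- v @- t' \<and> p = L_list x q"
proof -
  obtain q t1 where 1: "t = q @- t1" "p = L_list x q" "L x t1 = L_list x v @- s"
    using L_split[OF assms(1)] shd_L_list_shift[OF assms(2)] by metis
  obtain t2 where "s = L x t2"
    using L_split[OF 1(3)] assms(2) by metis
  with 1(3) have "L x t1 = L x (v @- t2)"
    by (simp add: L_shift)
  then have "t1 = v @- t2"
    using L_inj by metis
  with 1 show ?thesis by blast
qed

text \<open>The final \<open>x\<close> certifies that the last block is complete: \<open>[x]\<close>
  alone could be the code of \<open>x\<close> or the beginning of a block
  \<open>[x, b]\<close>.\<close>

lemma factors_L_iff: "L_list x v @ [x] \<in> factors (L x t) \<longleftrightarrow> v \<in> factors t"
proof
  assume "L_list x v @ [x] \<in> factors (L x t)"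
  then obtain p s where "L x t = p @- (L_list x v @ [x]) @- s" by (rule factorsE)
  then have "L x t = p @- L_list x v @- x ## s" by simp
  from L_decode[OF this] show "v \<in> factors t" by (auto intro: factorsI)
next
  assume "v \<in> factors t"
  then obtain p s where "t = p @- v @- s" by (rule factorsE)
  then have "L x t = L_list x p @- (L_list x v @ [x]) @- stl (L x s)"
    using shd_L[of x s] by (metis L_shift shift_append shift.simps stream.collapse)
  then show "L_list x v @ [x] \<in> factors (L x t)" by (rule factorsI)
qed

lemma is_prefix_L_iff: "is_prefix (L_list x v @ [x]) (L x t) \<longleftrightarrow> is_prefix v t"
proof
  assume "is_prefix (L_list x v @ [x]) (L x t)"
  then obtain s where "L x t = [] @- L_list x v @- x ## s"
    by (auto simp: is_prefix_def)
  from L_decode[OF this] obtain q t' where "t = q @- v @- t'" "[] = L_list x q"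
    by auto
  then show "is_prefix v t"
    using L_list_eq_Nil[of x q] by (auto simp: is_prefix_def)
next
  assume "is_prefix v t"
  then obtain s where "t = v @- s" by (auto simp: is_prefix_def)
  then have "L x t = (L_list x v @ [x]) @- stl (L x s)"
    using shd_L[of x s] by (metis L_shift shift_append shift.simps stream.collapse)
  then show "is_prefix (L_list x v @ [x]) (L x t)"
    by (auto simp: is_prefix_def)
qed

text \<open>The letter before a coded word ends a block, and the block of any letter,
  \<open>x\<close> included, ends with that letter. So left extensions are the same before and after
  coding.\<close>

lemma Cons_factors_L_iff:
  "a # L_list x v @ [x] \<in> factors (L x t) \<longleftrightarrow> a # v \<in> factors t"
proof
  assume "a # L_list x v @ [x] \<in> factors (L x t)"
  then obtain p s where "L x t = p @- (a # L_list x v @ [x]) @- s" by (rule factorsE)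
  then have "L x t = (p @ [a]) @- L_list x v @- x ## s" by simp
  from L_decode[OF this] obtain q t' where q: "t = q @- v @- t'" "p @ [a] = L_list x q"
    by auto
  then have "q \<noteq> []" by auto
  with q(2) have "last q = a"
    using last_L_list by (metis last_snoc)
  with \<open>q \<noteq> []\<close> have "q = butlast q @ [a]"
    by (metis append_butlast_last_id)
  then have "t = butlast q @- (a # v) @- t'"
    using q(1) by (metis shift_append append_Cons append_Nil)
  then show "a # v \<in> factors t" by (rule factorsI)
next
  assume "a # v \<in> factors t"
  then have "L_list x (a # v) @ [x] \<in> factors (L x t)"
    by (simp only: factors_L_iff)
  moreover have "L_list x (a # v) @ [x] = butlast (L_letter x a) @ (a # L_list x v @ [x]) @ []"
    by (simp add: L_letter_def)
  ultimately show "a # L_list x v @ [x] \<in> factors (L x t)"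
    by (metis factors_infix)
qed

lemma prefix_extensions_L_subset: "prefix_extensions (L x t) \<subseteq> prefix_extensions t"
proof
  fix a assume a: "a \<in> prefix_extensions (L x t)"
  have "a # stake k t \<in> factors t" for k
  proof -
    have "a # L_list x (stake k t) @ [x] \<in> factors (L x t)"
      by (rule prefix_extensionsD[OF a]) (simp add: is_prefix_L_iff is_prefix_stake)
    then show ?thesis
      by (simp only: Cons_factors_L_iff)
  qed
  then show "a \<in> prefix_extensions t"
    by (simp add: prefix_extensions_def)
qed

text \<open>Coding never shortens a word, and the closing \<open>x\<close> contributes the
  additional letter.\<close>

lemma stake_Suc_factor_L:
  assumes "a # stake k t \<in> factors t"
  shows "a # stake (Suc k) (L x t) \<in> factors (L x t)"
proof (rule stake_factor_le)
  let ?u = "L_list x (stake k t) @ [x]"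
  show "is_prefix ?u (L x t)"
    by (simp add: is_prefix_L_iff is_prefix_stake)
  show "a # ?u \<in> factors (L x t)"
    using assms by (simp add: Cons_factors_L_iff)
  show "Suc k \<le> length ?u"
    using length_L_list[of "stake k t" x] by simp
qed

section \<open>Directive words\<close>

text \<open>A letter other than \<open>x\<close> in \<open>L x t\<close> is the second letter of its
  block, so the inserted \<open>x\<close> puts it strictly further right than in
  \<open>t\<close>.\<close>

lemma snth_L_other:
  assumes "L x t !! p = a" and "a \<noteq> x"
  shows "\<exists>q<p. t !! q = a"
  using assms(1)
proof (induction p arbitrary: t rule: less_induct)
  case (less p)
  from less.prems assms(2) obtain p' where p: "p = Suc p'"
    using shd_L[of x t] by (cases p) auto
  show ?case
  proof (cases "shd t = x")
    case True
    with less.prems p have "L x (stl t) !! p' = a" by (simp add: L_same)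
    with less.IH p obtain q where "q < p'" "stl t !! q = a" by blast
    with p show ?thesis by (intro exI[of _ "Suc q"]) simp
  next
    case False
    show ?thesis
    proof (cases p')
      case 0
      with False less.prems p show ?thesis by (intro exI[of _ 0]) (simp add: L_other)
    next
      case (Suc p'')
      with False less.prems p have "L x (stl t) !! p'' = a" by (simp add: L_other)
      with less.IH p Suc obtain q where "q < p''" "stl t !! q = a"
        by (metis lessI less_SucI)
      with p Suc show ?thesis by (intro exI[of _ "Suc q"]) simp
    qed
  qed
qed

text \<open>As long as the directing letter differs from \<open>a\<close>, passing to the next word
  moves an occurrence of \<open>a\<close> strictly to the left, which cannot go on forever.\<close>

lemma directing_letter_ge:
  assumes S: "\<And>n. S n = L (x !! n) (S (Suc n))" and "S n !! p = a"
  shows "\<exists>m\<ge>n. x !! m = a"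
  using assms(2)
proof (induction p arbitrary: n rule: less_induct)
  case (less p)
  show ?case
  proof (cases "x !! n = a")
    case False
    with less.prems obtain q where "q < p" "S (Suc n) !! q = a"
      using snth_L_other S by metis
    with less.IH[of q "Suc n"] show ?thesis by (meson Suc_leD)
  qed auto
qed

lemma prefix_extensions_eq_Ult:
  assumes "directs x w"
  shows "prefix_extensions w = Ult x"
proof -
  obtain S where S: "S 0 = w" "\<And>n. S n = L (x !! n) (S (Suc n))"
    using assms unfolding directs_def by (elim exE conjE) (rule that, assumption, erule spec)
  show ?thesis
  proof (intro equalityI subsetI)
    fix a assume a: "a \<in> prefix_extensions w"
    have ext: "a \<in> prefix_extensions (S n)" for n
    proof (induction n)
      case 0
      with a S(1) show ?case by simp
    next
      case (Suc n)
      then show ?case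
        using prefix_extensions_L_subset[of "x !! n" "S (Suc n)"] S(2)[of n] by auto
    qed
    have "\<exists>m\<ge>n. x !! m = a" for n
    proof -
      have "[a] \<in> factors (S n)"
        using prefix_extensionsD[OF ext, of "[]"] by (simp add: is_prefix_def)
      then obtain p s where "S n = p @- [a] @- s" by (rule factorsE)
      then have "S n !! length p = a" by simp
      then show ?thesis by (rule directing_letter_ge[of S x, OF S(2)])
    qed
    then show "a \<in> Ult x"
      by (auto simp: Ult_def infinite_nat_iff_unbounded_le)
  next
    fix a assume "a \<in> Ult x"
    then have inf: "\<exists>m\<ge>n. x !! m = a" for n
      by (auto simp: Ult_def infinite_nat_iff_unbounded_le)
    \<comment> \<open>The induction on \<open>k\<close> needs all \<open>n\<close> at once: the
      prefix of \<open>S n\<close> gains its letter from the shorter prefix of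
      \<open>S (Suc n)\<close>.\<close>
    have "a # stake k (S n) \<in> factors (S n)" for k n
    proof (induction k arbitrary: n)
      case 0
      \<comment> \<open>The word \<open>S m\<close> begins with \<open>a\<close>; the occurrence of
        \<open>a\<close> is then carried back from \<open>S m\<close> to \<open>S n\<close>, one
        coding at a time.\<close>
      obtain m where "m \<ge> n" "x !! m = a"
        using inf by blast
      then have "[a] \<in> factors (S n)"
      proof (induction rule: inc_induct)
        case base
        then have "shd (S m) = a" using S(2)[of m] shd_L by metis
        then have "S m = [] @- [a] @- stl (S m)" using stream.collapse[of "S m"] by simp
        then show ?case by (rule factorsI)
      next
        case (step n)
        then have "a # stake 0 (S (Suc n)) \<in> factors (S (Suc n))" by simp
        from stake_Suc_factor_L[OF this, of "x !! n"] S(2)[of n]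
        have "[] @ [a] @ stake (Suc 0) (S n) \<in> factors (S n)" by simp
        then show ?case by (rule factors_infix)
      qed
      then show ?case by simp
    next
      case (Suc k)
      show ?case
        using stake_Suc_factor_L[OF Suc.IH[of "Suc n"], of "x !! n"] S(2)[of n] by simp
    qed
    from this[of _ 0] show "a \<in> prefix_extensions w"
      by (simp add: S(1) prefix_extensions_def)
  qed
qed

section \<open>Epistandard words have directive words\<close>

text \<open>Reads one block per step: it is \<open>[x]\<close> exactly if the next letter is
  \<open>x\<close> again. The first letter of \<open>w\<close> is not inspected;
  \<open>L_decode_eq\<close> assumes that it is \<open>x\<close>.\<close>

primcorec decode :: "'a \<Rightarrow> 'a stream \<Rightarrow> 'a stream" where
  "decode x w = (if shd (stl w) = x then x ## decode x (stl w)
                 else shd (stl w) ## decode x (stl (stl w)))"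

lemma L_decode_eq:
  assumes "shd w = x" and "\<And>i. w !! i = x \<or> w !! Suc i = x"
  shows "L x (decode x w) = w"
proof -
  have "L x (decode x w) !! n = w !! n" for n
    using assms
  proof (induction n arbitrary: w rule: less_induct)
    case (less n)
    show ?case
    proof (cases "shd (stl w) = x")
      case True
      then have eq: "L x (decode x w) = x ## L x (decode x (stl w))"
        by (subst L_same) simp_all
      show ?thesis
      proof (cases n)
        case 0
        with eq less.prems show ?thesis by simp
      next
        case (Suc m)
        have "L x (decode x (stl w)) !! m = stl w !! m"
          using less.IH[of m "stl w"] True less.prems(2)[of "Suc _"] Suc by simp
        with eq Suc show ?thesis by simp
      qed
    next
      case False
      then have eq: "L x (decode x w) = x ## shd (stl w) ## L x (decode x (stl (stl w)))"
        by (subst L_other) simp_all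
      have x2: "shd (stl (stl w)) = x"
        using False less.prems(2)[of 1] by simp
      consider "n = 0" | "n = 1" | m where "n = Suc (Suc m)"
        by (metis One_nat_def not0_implies_Suc)
      then show ?thesis
      proof cases
        case (3 m)
        have "L x (decode x (stl (stl w))) !! m = stl (stl w) !! m"
          using less.IH[of m "stl (stl w)"] x2 less.prems(2)[of "Suc (Suc _)"] 3 by simp
        with eq 3 show ?thesis by simp
      qed (use eq less.prems in simp_all)
    qed
  qed
  then have "(!!) (L x (decode x w)) = (!!) w" by blast
  then show ?thesis
    by (metis stream_smap_nats)
qed

text \<open>A letter other than \<open>shd w\<close> is not a prefix, hence not left special, so
  only one letter can precede it. If two such letters \<open>?y\<close>, \<open>?z\<close> were
  adjacent, reversal would make each the only predecessor of the other, and neither could ever occur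
  for the first time.\<close>

lemma epistandard_separating:
  assumes "epistandard w"
  shows "w !! i = shd w \<or> w !! Suc i = shd w"
proof (rule ccontr)
  let ?y = "w !! i" and ?z = "w !! Suc i"
  assume neq: "\<not> (?y = shd w \<or> ?z = shd w)"
  have rev: "\<And>u. u \<in> factors w \<Longrightarrow> rev u \<in> factors w"
    and special: "\<And>u. left_special w u \<Longrightarrow> is_prefix u w"
    using assms by (auto simp: epistandard_def episturmian_def)
  have unique: "c = d" if "[c, e] \<in> factors w" "[d, e] \<in> factors w" "e \<noteq> shd w" for c d e
  proof (rule ccontr)
    assume "c \<noteq> d"
    moreover have "[e] \<in> factors w"
      using that(1) factors_infix[of "[c]" "[e]" "[]"] by simp
    ultimately have "left_special w [e]"
      using that unfolding left_special_def by blast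
    from special[OF this] that(3) show False
      by (auto simp: is_prefix_def)
  qed
  have yz: "[?y, ?z] \<in> factors w"
    by (rule factors_pair)
  then have zy: "[?z, ?y] \<in> factors w"
    using rev by fastforce
  have "w !! j \<noteq> ?y \<and> w !! j \<noteq> ?z" for j
  proof (induction j)
    case 0
    with neq show ?case by auto
  next
    case (Suc j)
    then show ?case
      using unique[OF factors_pair[of w j]] yz zy neq by metis
  qed
  then show False by blast
qed

text \<open>The code \<open>L_list x v @ [x]\<close> commutes with reversal and preserves left
  special factors and prefixes, so both defining properties descend from \<open>w\<close> to
  \<open>t\<close>.\<close>

lemma epistandard_desubstitution:
  assumes "epistandard w"
  shows "\<exists>t. epistandard t \<and> w = L (shd w) t"
proof -
  define x where "x = shd w"
  define t where "t = decode x w"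
  have w: "w = L x t"
    unfolding t_def
    by (rule L_decode_eq[symmetric]) (use epistandard_separating[OF assms] in \<open>unfold x_def, blast+\<close>)
  have "rev v \<in> factors t" if "v \<in> factors t" for v
  proof -
    have "rev (L_list x v @ [x]) \<in> factors w"
      using assms that by (simp only: w epistandard_def episturmian_def factors_L_iff)
    then show ?thesis
      by (simp only: rev_L_list factors_L_iff w)
  qed
  moreover have prefix: "is_prefix v t" if v: "left_special t v" for v
  proof -
    have "left_special w (L_list x v @ [x])"
      using v unfolding left_special_def w factors_L_iff Cons_factors_L_iff .
    then have "is_prefix (L_list x v @ [x]) w"
      using assms by (simp add: epistandard_def)
    then show ?thesis
      by (simp add: w is_prefix_L_iff)
  qed
  \<comment> \<open>Two prefixes of \<open>t\<close> of the same length coincide.\<close>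
  moreover have "u = v" if "left_special t u" "left_special t v" "length u = length v" for u v
    using prefix[OF that(1)] prefix[OF that(2)] that(3) by (metis is_prefix_iff_stake)
  ultimately have "epistandard t"
    by (auto simp: epistandard_def episturmian_def)
  then show ?thesis
    using w[unfolded x_def] by (intro exI[of _ t] conjI)
qed

lemma epistandard_directs:
  assumes "epistandard w"
  shows "\<exists>x. directs x w"
proof -
  obtain f :: "'a stream \<Rightarrow> 'a stream" where f: "\<And>s. epistandard s \<Longrightarrow> epistandard (f s) \<and> s = L (shd s) (f s)"
    \<comment> \<open>Iterating the chosen \<open>f\<close> yields the words $s^{(n)}$; the
      directing letters are their first letters.\<close>
    using epistandard_desubstitution by metis
  define S where "S n = (f ^^ n) w" for n
  have epi: "epistandard (S n)" for n
    by (induction n) (simp_all add: S_def assms f[THEN conjunct1])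
  have "S n = L (smap (shd \<circ> S) nats !! n) (S (Suc n))" for n
    using f[THEN conjunct2, OF epi[of n]] unfolding S_def by simp
  moreover have "S 0 = w"
    by (simp add: S_def)
  ultimately show ?thesis
    unfolding directs_def by blast
qed

text \<open>Both letters extend every prefix of \<open>w\<close>, so every prefix is left special.
  As there is at most one left special factor of each length, there are no others.\<close>

lemma epistandard_if_two_extensions:
  assumes "episturmian (a ## w)" and "episturmian (b ## w)" and "a \<noteq> b"
  shows "epistandard w"
proof -
  have a: "a \<in> prefix_extensions w" and b: "b \<in> prefix_extensions w"
    using assms by (auto intro: prefix_extensions_if_episturmian_Stream)
  have epi: "episturmian w"
    using assms(1) factors_Stream_eq[OF a] episturmian_cong by metis
  have "left_special w (stake k w)" for k
  proof -
    have "a # stake k w \<in> factors w" "b # stake k w \<in> factors w"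
      using a b by (auto simp: prefix_extensions_def)
    moreover from this have "stake k w \<in> factors w"
      using factors_infix[of "[a]" "stake k w" "[]"] by simp
    ultimately show ?thesis
      using assms(3) unfolding left_special_def by blast
  qed
  then have "is_prefix u w" if "left_special w u" for u
    using epi that unfolding episturmian_def is_prefix_iff_stake
    by (metis length_stake)
  with epi show ?thesis
    by (simp add: epistandard_def)
qed

theorem theorem6:
  fixes A B :: "'a set" and w :: "'a stream"
  assumes "finite A"
    and "w \<in> streams A"
    and "B \<subseteq> A"
    and "\<exists>a\<in>B. \<exists>b\<in>B. a \<noteq> b"
  shows "ultimately_strict_epistandard B w \<longleftrightarrow>
         (\<forall>a\<in>A. episturmian (a ## w) \<longleftrightarrow> a \<in> B)"
proof -
  have Ult: "Ult (directive_word w) = prefix_extensions w" if "epistandard w"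
    using epistandard_directs[OF that] prefix_extensions_eq_Ult directive_word_eq by metis
  have ext: "episturmian (a ## w) \<longleftrightarrow> a \<in> prefix_extensions w" if "epistandard w" for a
    using that by (simp add: epistandard_def episturmian_Stream_iff)
  \<comment> \<open>Assertion (2) tests only letters of \<open>A\<close>; this inclusion turns it
    into the equality of $E(w)$ and $B$.\<close>
  have sub: "prefix_extensions w \<subseteq> A"
  proof
    fix a assume "a \<in> prefix_extensions w"
    then have "[a] \<in> factors w"
      using prefix_extensionsD[of a w "[]"] by (simp add: is_prefix_def)
    then obtain p s where "w = p @- [a] @- s" by (rule factorsE)
    then have "a \<in> sset w" by simp
    with assms(2) show "a \<in> A"
      by (auto simp: streams_iff_sset)
  qed
  have epi: "epistandard w" if "\<forall>a\<in>A. episturmian (a ## w) \<longleftrightarrow> a \<in> B"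
    using that assms(3,4) epistandard_if_two_extensions by (metis subsetD)
  show ?thesis
  proof
    assume "ultimately_strict_epistandard B w"
    then show "\<forall>a\<in>A. episturmian (a ## w) \<longleftrightarrow> a \<in> B"
      using Ult ext by (auto simp: ultimately_strict_epistandard_def)
  next
    assume asm: "\<forall>a\<in>A. episturmian (a ## w) \<longleftrightarrow> a \<in> B"
    then have "prefix_extensions w = B"
      using epi ext sub assms(3) by blast
    with Ult epi asm show "ultimately_strict_epistandard B w"
      by (simp add: ultimately_strict_epistandard_def)
  qed
qed

end
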